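(* Let $\mu>0$, $s>0$, $f\in\mathcal S^2_\mu$ and $x_0\in\mathbb R^n$. (a) Let $X_t$, $t\ge0$, be the solution of $$\ddot X_t+2\sqrt\mu\,\dot X_t+\sqrt s\,\nabla^2f(X_t)\dot X_t+(1+\sqrt{\mu s})\nabla f(X_t)=0,\qquad X(0)=x_0,\quad\dot X(0)=-\frac{2\sqrt s}{1+\sqrt{\mu s}}\nabla f(x_0).$$ Then $f(X_t)-f^*\le V_0e^{-\sqrt\mu\,t}$ for all $t\ge0$, where $$V_0=(1+\sqrt{\mu s})(f(x_0)-f^* )+\frac12\Big\|\sqrt\mu(x_0-x^* )-\sqrt s\,\frac{1-\sqrt{\mu s}}{1+\sqrt{\mu s}}\nabla f(x_0)\Big\|^2.$$ (b) Let $X_t$, $t\ge0$, be the solution of $$\ddot X_t+2\sqrt\mu\,\dot X_t+(1+\sqrt{\mu s})\nabla f(X_t)=0,\qquad X(0)=x_0,\quad\dot X(0)=-\frac{2\sqrt s}{1+\sqrt{\mu s}}\nabla f(x_0).$$ Then $f(X_t)-f^*\le V_0e^{-\sqrt\mu\,t}$ for all $t\ge0$, where $$V_0=(1+\sqrt{\mu s})(f(x_0)-f^* )+\frac12\Big\|\sqrt\mu(x_0-x^* )-\frac{2\sqrt s}{1+\sqrt{\mu s}}\nabla f(x_0)\Big\|^2.$$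
   Context: $\mathcal S^2_\mu$ is the set of twice continuously differentiable functions $f:\mathbb R^n\to\mathbb R$ that are $\mu$-strongly convex: $f(y)\ge f(x)+\langle\nabla f(x),y-x\rangle+\frac\mu2\|y-x\|^2$ for all $x,y\in\mathbb R^n$. $x^*$ is the unique minimizer of $f$, $f^*=f(x^* )$, and $\|\cdot\|$ is the Euclidean norm. *)

theory Defs
  imports "HOL-Analysis.Analysis"
begin

definition grad :: "(real ^ 'n \<Rightarrow> real) \<Rightarrow> real ^ 'n \<Rightarrow> real ^ 'n" where
  "grad f x = (THE g. GDERIV f x :> g)"

definition hessian :: "(real ^ 'n \<Rightarrow> real) \<Rightarrow> real ^ 'n \<Rightarrow> real ^ 'n ^ 'n" where
  "hessian f x = jacobian (grad f) (at x)"

definition twice_continuously_differentiable :: "(real ^ 'n \<Rightarrow> real) \<Rightarrow> bool" where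
  "twice_continuously_differentiable f \<longleftrightarrow>
     (\<forall>x. f differentiable at x) \<and> (\<forall>x. grad f differentiable at x) \<and>
     continuous_on UNIV (hessian f)"

definition strongly_convex :: "real \<Rightarrow> (real ^ 'n \<Rightarrow> real) \<Rightarrow> bool" where
  "strongly_convex \<mu> f \<longleftrightarrow>
     (\<forall>x y. f y \<ge> f x + grad f x \<bullet> (y - x) + \<mu> / 2 * (norm (y - x))\<^sup>2)"

definition S2 :: "real \<Rightarrow> (real ^ 'n \<Rightarrow> real) set" where
  "S2 \<mu> = {f. twice_continuously_differentiable f \<and> strongly_convex \<mu> f}"

definition minimizer :: "(real ^ 'n \<Rightarrow> real) \<Rightarrow> real ^ 'n" where
  "minimizer f = arg_min f (\<lambda>_. True)"

text \<open>The next lemmas show that \<open>grad\<close>, \<open>hessian\<close> and \<open>minimizer\<close>, which are defined by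
  description operators, denote the intended objects on \<^const>\<open>S2\<close>.\<close>

lemma GDERIV_grad:
  fixes f :: "real ^ 'n \<Rightarrow> real"
  assumes "f differentiable at x"
  shows "GDERIV f x :> grad f x"
proof -
  obtain D where D: "(f has_derivative D) (at x)"
    using assms by (auto simp: differentiable_def)
  then interpret bounded_linear D by (rule has_derivative_bounded_linear)
  define g where "g = adjoint D 1"
  have "D = (\<lambda>h. h \<bullet> g)"
    using adjoint_works[OF linear_axioms, of _ 1] by (auto simp: g_def)
  with D have g: "GDERIV f x :> g"
    unfolding gderiv_def by simp
  have "g' = g" if "GDERIV f x :> g'" for g'
  proof -
    have "(\<lambda>h. h \<bullet> g') = (\<lambda>h. h \<bullet> g)"
      using that g unfolding gderiv_def by (rule has_derivative_unique)
    then show ?thesis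
      by (metis inner_commute vector_eq_ldot)
  qed
  with g show ?thesis
    unfolding grad_def by (rule theI)
qed

lemma has_derivative_grad_hessian:
  fixes f :: "real ^ 'n \<Rightarrow> real"
  assumes "twice_continuously_differentiable f"
  shows "(grad f has_derivative (\<lambda>h. hessian f x *v h)) (at x)"
  using assms jacobian_works[of "grad f" "at x"]
  by (simp add: twice_continuously_differentiable_def hessian_def)

lemma ex1_minimizer:
  fixes f :: "real ^ 'n \<Rightarrow> real"
  assumes "\<mu> > 0" and "f \<in> S2 \<mu>"
  shows "\<exists>!x. \<forall>y. f x \<le> f y"
proof (rule ex_ex1I)
  have sc: "f y \<ge> f x + grad f x \<bullet> (y - x) + \<mu> / 2 * (norm (y - x))\<^sup>2" for x y
    using assms by (auto simp: S2_def strongly_convex_def)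
  have cont: "continuous_on S f" for S
    using assms by (intro differentiable_imp_continuous_on)
      (auto simp: S2_def twice_continuously_differentiable_def differentiable_on_def
        intro: differentiable_at_withinI)
  show "\<exists>x. \<forall>y. f x \<le> f y"
  proof -
    define R where "R = 2 * norm (grad f 0) / \<mu>"
    have "R \<ge> 0"
      using assms by (simp add: R_def)
    then obtain x where x: "\<forall>y\<in>cball 0 R. f x \<le> f y"
      using continuous_attains_inf[of "cball 0 R" f] cont by auto
    have "f x \<le> f y" if "y \<notin> cball 0 R" for y
    proof -
      have "norm (grad f 0) \<le> \<mu> / 2 * norm y"
        using that assms by (simp add: R_def field_simps)
      then have "norm (grad f 0) * norm y \<le> \<mu> / 2 * norm y * norm y"
        by (rule mult_right_mono) simp
      moreover have "- (norm (grad f 0) * norm y) \<le> grad f 0 \<bullet> y"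
        using Cauchy_Schwarz_ineq2[of "grad f 0" y] by linarith
      ultimately have "f 0 \<le> f y"
        using sc[of 0 y] by (simp add: power2_eq_square)
      moreover have "f x \<le> f 0"
        using x \<open>R \<ge> 0\<close> by simp
      ultimately show ?thesis by simp
    qed
    with x show ?thesis by blast
  qed
next
  fix x y
  assume x: "\<forall>z. f x \<le> f z" and y: "\<forall>z. f y \<le> f z"
  have sc: "f y \<ge> f x + grad f x \<bullet> (y - x) + \<mu> / 2 * (norm (y - x))\<^sup>2" for x y
    using assms by (auto simp: S2_def strongly_convex_def)
  define m where "m = (1/2) *\<^sub>R (x + y)"
  have "x + y = 2 *\<^sub>R m"
    by (simp add: m_def)
  then have ym: "y - m = - (x - m)"
    by (simp add: algebra_simps scaleR_2)
  have "f x + f y \<ge> 2 * f m + \<mu> * (norm (x - m))\<^sup>2"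
    using sc[where x=m and y=x] sc[where x=m and y=y]
    unfolding ym inner_minus_right norm_minus_cancel by linarith
  moreover have "f x \<le> f m" "f y \<le> f m"
    using x y by auto
  ultimately have "\<mu> * (norm (x - m))\<^sup>2 \<le> 0"
    by linarith
  then have "x = m"
    using assms by (simp add: mult_le_0_iff)
  with ym show "x = y" by simp
qed

lemma minimizer_le:
  fixes f :: "real ^ 'n \<Rightarrow> real"
  assumes "\<mu> > 0" and "f \<in> S2 \<mu>"
  shows "f (minimizer f) \<le> f y"
proof -
  obtain x where "\<forall>z. f x \<le> f z"
    using ex1_minimizer[OF assms] by blast
  then show ?thesis
    unfolding minimizer_def by - (rule arg_minI[of "\<lambda>_. True" x], auto simp: not_less)
qed

end

theory Submission
  imports Defs
begin

text \<open>Both flows are instances of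
  \<open>X'' + 2 a X' + d \<nabla>\<^sup>2f(X) X' + c \<nabla>f(X) = 0\<close> with \<open>a = sqrt \<mu>\<close>, \<open>c = 1 + sqrt (\<mu> s)\<close> and
  \<open>d = sqrt s\<close> in (a), \<open>d = 0\<close> in (b); only \<open>c \<ge> 1 + a d\<close> matters. The Lyapunov function
  \<open>V = c (f(X) - f(x*)) + \<parallel>X' + a (X - x*) + d \<nabla>f(X)\<parallel>\<^sup>2 / 2\<close> dominates \<open>f(X) - f(x*)\<close>, and
  strong convexity between \<open>X\<close> and \<open>x*\<close> gives \<open>V' \<le> - a V\<close>, so \<open>exp (a t) V(t)\<close> is
  nonincreasing.\<close>

text \<open>Multiplying by the integrating factor \<open>exp (a * t)\<close> turns the differential
  inequality into a sign condition on the derivative of the product. The mean value theorem on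
  \<open>{0..t}\<close>, an interval of positive length once \<open>t = 0\<close> is split off, then
  compares the endpoints.\<close>

lemma exp_decay_if_derivative_le:
  fixes V V' :: "real \<Rightarrow> real"
  assumes der: "\<And>t. t \<ge> 0 \<Longrightarrow> (V has_real_derivative V' t) (at t within {0..})"
    and le: "\<And>t. t \<ge> 0 \<Longrightarrow> V' t \<le> - a * V t"
    and "t \<ge> 0"
  shows "V t \<le> V 0 * exp (- a * t)"
proof (cases "t = 0")
  case False
  with \<open>t \<ge> 0\<close> have "0 < t" by simp
  define E where "E = (\<lambda>t. exp (a * t) * V t)"
  have "(E has_real_derivative exp (a * u) * (V' u + a * V u)) (at u within {0..t})"
    if "u \<in> {0..t}" for u
  proof -
    have "(V has_real_derivative V' u) (at u within {0..t})"
      using that by (intro DERIV_subset[OF der]) auto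
    then show ?thesis
      unfolding E_def by (auto intro!: derivative_eq_intros simp: algebra_simps)
  qed
  then obtain u where u: "u \<in> {0<..<t}"
    and eq: "E t - E 0 = (exp (a * u) * (V' u + a * V u)) * (t - 0)"
    using mvt_simple[OF \<open>0 < t\<close>, of E "\<lambda>u. (*) (exp (a * u) * (V' u + a * V u))"]
    by (auto simp: has_field_derivative_def)
  have "V' u + a * V u \<le> 0"
    using le[of u] u by simp
  then have "(exp (a * u) * (V' u + a * V u)) * t \<le> 0"
    using \<open>0 < t\<close> by (intro mult_nonpos_nonneg mult_nonneg_nonpos) auto
  with eq have "exp (a * t) * V t \<le> V 0"
    by (simp add: E_def)
  then show ?thesis
    by (simp add: exp_minus field_simps)
qed simp

text \<open>With \<open>v = X'\<close>, \<open>y = X - x*\<close>, \<open>g = \<nabla>f(X)\<close>, \<open>F = f(X) - f(x*)\<close> and \<open>- a v - c g\<close> the derivative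
  of \<open>v + a y + d g\<close> along the flow, this is \<open>V' \<le> - a V\<close>.\<close>

lemma lyapunov_derivative_le:
  fixes v y g :: "'a :: real_inner"
  assumes "a \<ge> 0" "d \<ge> 0" "c \<ge> 1 + a * d"
    and F: "F \<le> g \<bullet> y - a\<^sup>2 / 2 * (norm y)\<^sup>2"
  shows "c * (g \<bullet> v) + (v + a *\<^sub>R y + d *\<^sub>R g) \<bullet> (- (a *\<^sub>R v) - c *\<^sub>R g)
    \<le> - a * (c * F + 1 / 2 * (norm (v + a *\<^sub>R y + d *\<^sub>R g))\<^sup>2)"
    (is "?D \<le> - a * ?V")
proof -
  have "c \<ge> 0"
    using assms(1-3) by (smt (verit) mult_nonneg_nonneg)
  \<comment> \<open>The products of \<open>v\<close> with \<open>y\<close> and with \<open>g\<close>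
    cancel. Of the mixed term in \<open>g\<close> and \<open>y\<close>, the part with factor
    \<open>a * c\<close> goes into the convexity gap of \<open>F\<close>; the rest,
    \<open>a\<^sup>2 * d\<close>, is completed to the square of
    \<open>a\<^sup>2 *\<^sub>R y - g\<close>. The surplus of \<open>c\<close> over
    \<open>1 + a * d\<close> is collected in the last term, so each summand has a sign.\<close>
  have slack: "?D + a * ?V = a * c * (F - (g \<bullet> y - a\<^sup>2 / 2 * (y \<bullet> y))) - a / 2 * (v \<bullet> v)
      - d / 2 * ((a\<^sup>2 *\<^sub>R y - g) \<bullet> (a\<^sup>2 *\<^sub>R y - g)) - (d / 2 + a * d\<^sup>2 / 2) * (g \<bullet> g)
      - (c - (1 + a * d)) * (a ^ 3 / 2 * (y \<bullet> y) + d * (g \<bullet> g))"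
    unfolding power2_norm_eq_inner
    by (simp add: inner_simps inner_commute[of g v] inner_commute[of g y] inner_commute[of y v]
        algebra_simps power2_eq_square power3_eq_cube)
       (simp add: field_simps)
  have "a * c * (F - (g \<bullet> y - a\<^sup>2 / 2 * (y \<bullet> y))) \<le> 0"
    using F \<open>a \<ge> 0\<close> \<open>c \<ge> 0\<close>
    by (intro mult_nonneg_nonpos) (auto simp: power2_norm_eq_inner)
  moreover have "0 \<le> a / 2 * (v \<bullet> v)" "0 \<le> d / 2 * ((a\<^sup>2 *\<^sub>R y - g) \<bullet> (a\<^sup>2 *\<^sub>R y - g))"
    "0 \<le> (d / 2 + a * d\<^sup>2 / 2) * (g \<bullet> g)"
    "0 \<le> (c - (1 + a * d)) * (a ^ 3 / 2 * (y \<bullet> y) + d * (g \<bullet> g))"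
    using assms(1-3) by (auto intro!: mult_nonneg_nonneg add_nonneg_nonneg)
  ultimately have "?D + a * ?V \<le> 0"
    using slack by linarith
  then show ?thesis by simp
qed

text \<open>The initial velocity stays free here, so the constant in front of the exponential is
  just V(0); the prescribed \<open>X' 0\<close> enters only in the theorem.\<close>

lemma inertial_flow_exp_decay:
  fixes f :: "real ^ 'n \<Rightarrow> real" and X X' X'' :: "real \<Rightarrow> real ^ 'n"
  assumes "\<mu> > 0" and f: "f \<in> S2 \<mu>"
    and "d \<ge> 0" and c: "c \<ge> 1 + sqrt \<mu> * d"
    and X: "\<And>t. t \<ge> 0 \<Longrightarrow> (X has_vector_derivative X' t) (at t within {0..})"
    and X': "\<And>t. t \<ge> 0 \<Longrightarrow> (X' has_vector_derivative X'' t) (at t within {0..})"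
    and ode: "\<And>t. t \<ge> 0 \<Longrightarrow> X'' t + (2 * sqrt \<mu>) *\<^sub>R X' t
      + d *\<^sub>R (hessian f (X t) *v X' t) + c *\<^sub>R grad f (X t) = 0"
    and "t \<ge> 0"
  shows "f (X t) - f (minimizer f) \<le>
    (c * (f (X 0) - f (minimizer f))
      + 1 / 2 * (norm (X' 0 + sqrt \<mu> *\<^sub>R (X 0 - minimizer f) + d *\<^sub>R grad f (X 0)))\<^sup>2)
    * exp (- sqrt \<mu> * t)"
proof -
  define a where "a = sqrt \<mu>"
  define xm where "xm = minimizer f"
  have a: "a \<ge> 0" "a\<^sup>2 = \<mu>" and c': "c \<ge> 1 + a * d"
    using \<open>\<mu> > 0\<close> c by (auto simp: a_def)
  have tcd: "twice_continuously_differentiable f"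
    and sc: "f y \<ge> f x + grad f x \<bullet> (y - x) + \<mu> / 2 * (norm (y - x))\<^sup>2" for x y
    using f by (auto simp: S2_def strongly_convex_def)
  \<comment> \<open>Including \<open>d *\<^sub>R grad f (X t)\<close> makes the derivative of
    \<open>W\<close> produce exactly the Hessian term of the equation. Substituting the equation
    removes it together with \<open>X''\<close> and one of the two copies of
    \<open>a *\<^sub>R X'\<close>, leaving only first-order quantities.\<close>
  define W where "W = (\<lambda>t. X' t + a *\<^sub>R (X t - xm) + d *\<^sub>R grad f (X t))"
  define V where "V = (\<lambda>t. c * (f (X t) - f xm) + 1 / 2 * (norm (W t))\<^sup>2)"
  define V' where
    "V' = (\<lambda>t. c * (grad f (X t) \<bullet> X' t) + W t \<bullet> (- (a *\<^sub>R X' t) - c *\<^sub>R grad f (X t)))"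
  have "(V has_real_derivative V' u) (at u within {0..})" if "u \<ge> 0" for u
  proof -
    have fX: "((\<lambda>t. f (X t)) has_real_derivative grad f (X u) \<bullet> X' u) (at u within {0..})"
    proof -
      have "(f has_derivative (\<lambda>h. h \<bullet> grad f (X u))) (at (X u))"
        using GDERIV_grad[of f "X u"] tcd
        by (auto simp: twice_continuously_differentiable_def gderiv_def)
      from has_derivative_compose[OF X[OF that, unfolded has_vector_derivative_def] this]
      show ?thesis
        by (simp add: has_field_derivative_def inner_commute mult_commute_abs)
    qed
    have gX: "((\<lambda>t. grad f (X t)) has_vector_derivative hessian f (X u) *v X' u)
        (at u within {0..})"
      using has_derivative_compose[OF X[OF that, unfolded has_vector_derivative_def]
          has_derivative_grad_hessian[OF tcd]]
      by (simp add: has_vector_derivative_def matrix_vector_mult_scaleR)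
    have "(W has_vector_derivative
        X'' u + a *\<^sub>R X' u + d *\<^sub>R (hessian f (X u) *v X' u)) (at u within {0..})"
      unfolding W_def
      by (rule derivative_eq_intros X[OF that] X'[OF that] gX refl | simp)+
    moreover have "X'' u + a *\<^sub>R X' u + d *\<^sub>R (hessian f (X u) *v X' u)
        = - (a *\<^sub>R X' u) - c *\<^sub>R grad f (X u)"
    proof -
      have "(2 * a) *\<^sub>R X' u = a *\<^sub>R X' u + a *\<^sub>R X' u"
        by (simp flip: scaleR_add_left)
      with ode[OF that] show ?thesis
        unfolding a_def[symmetric] by (simp add: add_eq_0_iff2 algebra_simps)
    qed
    ultimately have W: "(W has_derivative (\<lambda>h. h *\<^sub>R (- (a *\<^sub>R X' u) - c *\<^sub>R grad f (X u))))
        (at u within {0..})"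
      by (simp add: has_vector_derivative_def)
    have "((\<lambda>t. W t \<bullet> W t) has_real_derivative
        2 * (W u \<bullet> (- (a *\<^sub>R X' u) - c *\<^sub>R grad f (X u)))) (at u within {0..})"
      unfolding has_field_derivative_def
      by (rule has_derivative_eq_rhs[OF has_derivative_inner[OF W W]])
         (simp add: fun_eq_iff inner_commute algebra_simps)
    with fX show ?thesis
      unfolding V_def V'_def power2_norm_eq_inner
      by (auto intro!: derivative_eq_intros)
  qed
  moreover have "V' u \<le> - a * V u" for u
  proof -
    \<comment> \<open>Strong convexity is used with base point \<open>X u\<close> and target
      \<open>xm\<close>, which bounds the gap from above; \<open>a\<^sup>2\<close> is the modulus
      \<mu>.\<close>
    have "f (X u) - f xm \<le> grad f (X u) \<bullet> (X u - xm) - a\<^sup>2 / 2 * (norm (X u - xm))\<^sup>2"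
      using sc[where x = "X u" and y = xm] a
      by (simp add: inner_diff_right norm_minus_commute)
    from lyapunov_derivative_le[OF a(1) \<open>d \<ge> 0\<close> c' this] show ?thesis
      unfolding V_def V'_def W_def .
  qed
  ultimately have "V t \<le> V 0 * exp (- a * t)"
    using \<open>t \<ge> 0\<close> by (intro exp_decay_if_derivative_le) auto
  moreover have "f (X t) - f xm \<le> V t"
  proof -
    \<comment> \<open>Minimality makes the gap nonnegative, so multiplying it by \<open>c\<close>,
      which is at least 1, can only enlarge it.\<close>
    have "0 \<le> f (X t) - f xm"
      using minimizer_le[OF \<open>\<mu> > 0\<close> f] by (simp add: xm_def)
    moreover have "1 \<le> c"
      using c' a(1) \<open>d \<ge> 0\<close> by (smt (verit) mult_nonneg_nonneg)
    ultimately have "1 * (f (X t) - f xm) \<le> c * (f (X t) - f xm)"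
      by (intro mult_right_mono)
    then show ?thesis
      by (simp add: V_def add_increasing2)
  qed
  ultimately show ?thesis
    by (simp add: V_def W_def a_def xm_def)
qed

theorem proposition2:
  fixes f :: "real ^ 'n \<Rightarrow> real" and \<mu> s :: real and x0 :: "real ^ 'n"
  assumes "\<mu> > 0" and "s > 0" and "f \<in> S2 \<mu>"
  shows
    "(\<forall>X X' X'' :: real \<Rightarrow> real ^ 'n.
        (\<forall>t\<ge>0. (X has_vector_derivative X' t) (at t within {0..})) \<and>
        (\<forall>t\<ge>0. (X' has_vector_derivative X'' t) (at t within {0..})) \<and>
        (\<forall>t\<ge>0. X'' t + (2 * sqrt \<mu>) *\<^sub>R X' t + sqrt s *\<^sub>R (hessian f (X t) *v X' t)
                  + (1 + sqrt (\<mu> * s)) *\<^sub>R grad f (X t) = 0) \<and>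
        X 0 = x0 \<and>
        X' 0 = - ((2 * sqrt s / (1 + sqrt (\<mu> * s))) *\<^sub>R grad f x0)
        \<longrightarrow>
        (\<forall>t\<ge>0. f (X t) - f (minimizer f) \<le>
           ((1 + sqrt (\<mu> * s)) * (f x0 - f (minimizer f))
             + 1 / 2 * (norm (sqrt \<mu> *\<^sub>R (x0 - minimizer f)
                 - (sqrt s * ((1 - sqrt (\<mu> * s)) / (1 + sqrt (\<mu> * s)))) *\<^sub>R grad f x0))\<^sup>2)
           * exp (- sqrt \<mu> * t)))
     \<and>
     (\<forall>X X' X'' :: real \<Rightarrow> real ^ 'n.
        (\<forall>t\<ge>0. (X has_vector_derivative X' t) (at t within {0..})) \<and>
        (\<forall>t\<ge>0. (X' has_vector_derivative X'' t) (at t within {0..})) \<and>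
        (\<forall>t\<ge>0. X'' t + (2 * sqrt \<mu>) *\<^sub>R X' t
                  + (1 + sqrt (\<mu> * s)) *\<^sub>R grad f (X t) = 0) \<and>
        X 0 = x0 \<and>
        X' 0 = - ((2 * sqrt s / (1 + sqrt (\<mu> * s))) *\<^sub>R grad f x0)
        \<longrightarrow>
        (\<forall>t\<ge>0. f (X t) - f (minimizer f) \<le>
           ((1 + sqrt (\<mu> * s)) * (f x0 - f (minimizer f))
             + 1 / 2 * (norm (sqrt \<mu> *\<^sub>R (x0 - minimizer f)
                 - (2 * sqrt s / (1 + sqrt (\<mu> * s))) *\<^sub>R grad f x0))\<^sup>2)
           * exp (- sqrt \<mu> * t)))"
proof -
  have c: "1 + sqrt (\<mu> * s) = 1 + sqrt \<mu> * sqrt s" "1 + sqrt (\<mu> * s) > 0"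
    using assms by (auto simp: real_sqrt_mult intro: add_pos_nonneg)
  \<comment> \<open>In (a), the initial velocity and the gradient term of W(0) with
    \<open>d = sqrt s\<close> merge into one multiple of the gradient, the one in the claimed
    constant.\<close>
  have V0: "- ((2 * sqrt s / (1 + sqrt (\<mu> * s))) *\<^sub>R g) + y + sqrt s *\<^sub>R g
      = y - (sqrt s * ((1 - sqrt (\<mu> * s)) / (1 + sqrt (\<mu> * s)))) *\<^sub>R g" for g y :: "real ^ 'n"
  proof -
    have "sqrt s - 2 * sqrt s / (1 + sqrt (\<mu> * s))
        = - (sqrt s * ((1 - sqrt (\<mu> * s)) / (1 + sqrt (\<mu> * s))))"
      using c(2) by (simp add: field_simps)
    then have "sqrt s *\<^sub>R g - (2 * sqrt s / (1 + sqrt (\<mu> * s))) *\<^sub>R g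
        = - ((sqrt s * ((1 - sqrt (\<mu> * s)) / (1 + sqrt (\<mu> * s)))) *\<^sub>R g)"
      by (metis scaleR_diff_left scaleR_minus_left)
    then show ?thesis by (simp add: algebra_simps)
  qed
  show ?thesis
  proof (intro conjI allI impI; elim conjE)
    fix X X' X'' :: "real \<Rightarrow> real ^ 'n" and t :: real
    assume "t \<ge> 0" and X: "\<forall>t\<ge>0. (X has_vector_derivative X' t) (at t within {0..})"
      "\<forall>t\<ge>0. (X' has_vector_derivative X'' t) (at t within {0..})"
      and ode: "\<forall>t\<ge>0. X'' t + (2 * sqrt \<mu>) *\<^sub>R X' t + sqrt s *\<^sub>R (hessian f (X t) *v X' t)
                  + (1 + sqrt (\<mu> * s)) *\<^sub>R grad f (X t) = 0"
      and init: "X 0 = x0" "X' 0 = - ((2 * sqrt s / (1 + sqrt (\<mu> * s))) *\<^sub>R grad f x0)"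
    show "f (X t) - f (minimizer f) \<le>
           ((1 + sqrt (\<mu> * s)) * (f x0 - f (minimizer f))
             + 1 / 2 * (norm (sqrt \<mu> *\<^sub>R (x0 - minimizer f)
                 - (sqrt s * ((1 - sqrt (\<mu> * s)) / (1 + sqrt (\<mu> * s)))) *\<^sub>R grad f x0))\<^sup>2)
           * exp (- sqrt \<mu> * t)"
      \<comment> \<open>With \<open>d = sqrt s\<close> the condition on \<open>c\<close> holds with
        equality, by \<open>c(1)\<close>.\<close>
      using inertial_flow_exp_decay[of \<mu> f "sqrt s" "1 + sqrt (\<mu> * s)" X X' X'' t]
        assms c(1) X ode \<open>t \<ge> 0\<close>
      unfolding init V0 by simp
  next
    fix X X' X'' :: "real \<Rightarrow> real ^ 'n" and t :: real
    assume "t \<ge> 0" and X: "\<forall>t\<ge>0. (X has_vector_derivative X' t) (at t within {0..})"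
      "\<forall>t\<ge>0. (X' has_vector_derivative X'' t) (at t within {0..})"
      and ode: "\<forall>t\<ge>0. X'' t + (2 * sqrt \<mu>) *\<^sub>R X' t
                  + (1 + sqrt (\<mu> * s)) *\<^sub>R grad f (X t) = 0"
      and init: "X 0 = x0" "X' 0 = - ((2 * sqrt s / (1 + sqrt (\<mu> * s))) *\<^sub>R grad f x0)"
    show "f (X t) - f (minimizer f) \<le>
           ((1 + sqrt (\<mu> * s)) * (f x0 - f (minimizer f))
             + 1 / 2 * (norm (sqrt \<mu> *\<^sub>R (x0 - minimizer f)
                 - (2 * sqrt s / (1 + sqrt (\<mu> * s))) *\<^sub>R grad f x0))\<^sup>2)
           * exp (- sqrt \<mu> * t)"
      \<comment> \<open>With \<open>d = 0\<close> the Hessian term drops out, and W(0) is the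
        initial velocity plus \<open>sqrt \<mu> *\<^sub>R (x0 - minimizer f)\<close>, as in the
        constant of (b).\<close>
      using inertial_flow_exp_decay[of \<mu> f 0 "1 + sqrt (\<mu> * s)" X X' X'' t]
        assms X ode \<open>t \<ge> 0\<close>
      unfolding init by simp
  qed
qed

end
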